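(* For all integers $m\ge0$ and $n\ge2$, $$\overset{\circ}{\chi}_n(\mathcal S[m])=\overset{\circ}{\chi}_n(\mathcal K_n[m]).$$
   Context: A partition is a weakly decreasing sequence $\lambda=(\lambda_1\ge\lambda_2\ge\cdots)$ of non-negative integers, all but finitely many zero; $|\lambda|=\sum_i\lambda_i$. Young walls of type $D^{(2)}_{n+1}$ (built on the ground-state wall $Y_{\Lambda_0}$) consist of columns numbered from right to left, and are encoded by partitions: $\lambda_i$ is the number of blocks in the $i$-th column above the ground-state wall. With $\Delta=n+1$, the set $\mathcal F_n$ of proper Young walls and the set $\mathcal K_n$ of reduced (proper) Young walls are, under this encoding, $$\mathcal F_n=\{\lambda \text{ a partition}\mid \lambda_i=\lambda_{i+1}\text{ implies }\lambda_i=t\Delta\text{ for some }t\in\mathbb Z_{\ge0}\},$$ $$\mathcal K_n=\{\lambda\in\mathcal F_n\mid \lambda_i-\lambda_{i+1}\le 2\Delta\text{ for all } i,\text{ with equality only if }\lambda_i\ne t\Delta\text{ for all }t\in\mathbb Z_{\ge0}\}.$$ The set of strict partitions is $\mathcal S=\{\lambda\in\mathcal F_n\mid \lambda_i=\lambda_{i+1}\text{ implies }\lambda_i=0\}$; as a set it does not depend on $n$. For $\mathcal A\subset\mathcal F_n$, $\mathcal A[m]=\{\lambda\in\mathcal A\mid|\lambda|=m\}$. Weights: the blocks above the ground-state wall in each column have colors in $I=\{0,1,\dots,n\}$, which read from bottom to top form the sequence $0,1,\dots,n-1,n,n,n-1,\dots,1,0$ repeated periodically with period $2\Delta$ (so a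 column with $\lambda_j$ blocks uses the first $\lambda_j$ terms). The weight of $\lambda\in\mathcal F_n$ is $\mathrm{wt}(\lambda)=\Lambda_0-\sum_{i\in I}a_i\alpha_i$, where $a_i$ is the total number of blocks of color $i$ above the ground-state wall in all columns. Here $\Lambda_0$ is the $0$-th fundamental weight and $\alpha_0,\dots,\alpha_n$ are the (linearly independent) simple roots in the weight lattice $P$ of type $D^{(2)}_{n+1}$. For $\mathcal A\subset\mathcal F_n$ and $\mu\in P$, $\mathcal A[\mu]=\{\lambda\in\mathcal A\mid\mathrm{wt}(\lambda)=\mu\}$, and the virtual character of $\mathcal A$ is $$\overset{\circ}{\chi}_n(\mathcal A)=\sum_{\mu\in P}|\mathcal A[\mu]|\,e(\mu),$$ where the $e(\mu)$ are the basis elements of the group algebra $\mathbb Z[P]$, $e(\mu)e(\nu)=e(\mu+\nu)$ (infinite formal sums allowed). *)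

theory Defs
  imports "HOL-Library.Poly_Mapping"
begin

section \<open>Partitions\<close>

text \<open>Sequences are indexed from 0: the value \<open>l i\<close> is the part $\lambda_{i+1}$, that is, the number
  of blocks above the ground-state wall in the column number \<open>i + 1\<close> from the right.\<close>

definition is_partition :: "(nat \<Rightarrow> nat) \<Rightarrow> bool" where
  "is_partition l \<longleftrightarrow> (\<forall>i. l (Suc i) \<le> l i) \<and> finite {i. l i \<noteq> 0}"

definition psize :: "(nat \<Rightarrow> nat) \<Rightarrow> nat" where
  "psize l = (\<Sum>i | l i \<noteq> 0. l i)"

definition Delta :: "nat \<Rightarrow> nat" where
  "Delta n = n + 1"

definition proper_walls :: "nat \<Rightarrow> (nat \<Rightarrow> nat) set" where
  "proper_walls n = {l. is_partition l \<and> (\<forall>i. l i = l (Suc i) \<longrightarrow> (\<exists>t. l i = t * Delta n))}"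

text \<open>The subtraction of natural numbers below is exact, since \<open>l\<close> is weakly decreasing.\<close>

definition reduced_walls :: "nat \<Rightarrow> (nat \<Rightarrow> nat) set" where
  "reduced_walls n = {l \<in> proper_walls n. \<forall>i. l i - l (Suc i) \<le> 2 * Delta n \<and>
     (l i - l (Suc i) = 2 * Delta n \<longrightarrow> (\<forall>t. l i \<noteq> t * Delta n))}"

definition strict_partitions :: "nat \<Rightarrow> (nat \<Rightarrow> nat) set" where
  "strict_partitions n = {l \<in> proper_walls n. \<forall>i. l i = l (Suc i) \<longrightarrow> l i = 0}"

lemma strict_partitions_eq:
  "strict_partitions n = {l. is_partition l \<and> (\<forall>i. l i = l (Suc i) \<longrightarrow> l i = 0)}"
  by (auto simp: strict_partitions_def proper_walls_def)

definition of_size :: "(nat \<Rightarrow> nat) set \<Rightarrow> nat \<Rightarrow> (nat \<Rightarrow> nat) set" where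
  "of_size A m = {l \<in> A. psize l = m}"

section \<open>The weight lattice of type $D^{(2)}_{n+1}$\<close>

text \<open>The affine weight lattice is the free abelian group
  $P = \bigoplus_{i=0}^n \mathbb{Z}\Lambda_i \oplus \mathbb{Z}\delta$. The lattices for all \<open>n\<close> live in
  one ambient free abelian group.\<close>

datatype weight_gen = Fund nat | Null

type_synonym weight = "weight_gen \<Rightarrow>\<^sub>0 int"

definition weight_lattice :: "nat \<Rightarrow> weight set" where
  "weight_lattice n = {mu. Poly_Mapping.keys mu \<subseteq> Fund ` {..n} \<union> {Null}}"

text \<open>The entry $a_{ij} = \langle h_i, \alpha_j\rangle$ of the Cartan matrix of type $D^{(2)}_{n+1}$
  ($n \ge 2$, $0 \le i, j \le n$).\<close>

definition cartan :: "nat \<Rightarrow> nat \<Rightarrow> nat \<Rightarrow> int" where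
  "cartan n i j =
     (if i = j then 2
      else if (i = 0 \<and> j = 1) \<or> (i = n \<and> j + 1 = n) then - 2
      else if i = j + 1 \<or> j = i + 1 then - 1
      else 0)"

definition fund_weight :: "nat \<Rightarrow> weight" where
  "fund_weight i = frag_of (Fund i)"

text \<open>With $\langle h_i, \Lambda_j\rangle = \delta_{ij}$, $\langle d, \Lambda_j\rangle = 0$,
  $\langle h_i, \delta\rangle = 0$, $\langle d, \delta\rangle = 1$ and
  $\langle d, \alpha_j\rangle = \delta_{j0}$ one gets
  $\alpha_j = \sum_i a_{ij} \Lambda_i + \delta_{j0}\,\delta$.\<close>

definition simple_root :: "nat \<Rightarrow> nat \<Rightarrow> weight" where
  "simple_root n j =
     (\<Sum>i\<le>n. frag_cmul (cartan n i j) (fund_weight i)) + (if j = 0 then frag_of Null else 0)"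

lemma lookup_sum_frag_cmul:
  "Poly_Mapping.lookup (\<Sum>i\<in>A. frag_cmul (c i) (f i)) x = (\<Sum>i\<in>A. c i * Poly_Mapping.lookup (f i) x)"
  by (simp add: lookup_sum)

lemma lookup_simple_root_Fund:
  assumes "i \<le> n"
  shows "Poly_Mapping.lookup (simple_root n j) (Fund i) = cartan n i j"
  using assms
  by (simp add: simple_root_def lookup_add lookup_sum_frag_cmul fund_weight_def
      if_distrib [of "\<lambda>x. _ * x"] cong: if_cong)

lemma lookup_simple_root_Null:
  "Poly_Mapping.lookup (simple_root n j) Null = (if j = 0 then 1 else 0)"
  by (simp add: simple_root_def lookup_add lookup_sum_frag_cmul fund_weight_def)

lemma simple_roots_independent:
  assumes n: "n \<ge> 2" and eq: "(\<Sum>j\<le>n. frag_cmul (c j) (simple_root n j)) = 0" and "i \<le> n"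
  shows "c i = 0"
  using \<open>i \<le> n\<close>
proof (induction i rule: less_induct)
  case (less i)
  show ?case
  proof (cases i)
    case 0
    have "0 = Poly_Mapping.lookup (\<Sum>j\<le>n. frag_cmul (c j) (simple_root n j)) Null"
      by (simp add: eq)
    also have "\<dots> = c 0"
      by (simp add: lookup_sum_frag_cmul lookup_simple_root_Null
          if_distrib [of "\<lambda>x. _ * x"] cong: if_cong)
    finally show ?thesis
      using 0 by simp
  next
    case (Suc k)
    have "0 = Poly_Mapping.lookup (\<Sum>j\<le>n. frag_cmul (c j) (simple_root n j)) (Fund k)"
      by (simp add: eq)
    also have "\<dots> = (\<Sum>j\<le>n. c j * cartan n k j)"
      using less.prems Suc by (simp add: lookup_sum_frag_cmul lookup_simple_root_Fund)
    also have "\<dots> = (\<Sum>j\<le>n. if j = i then c j * cartan n k j else 0)"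
      using less.IH Suc less.prems
      by (intro sum.cong) (auto simp: cartan_def not_less_eq)
    also have "\<dots> = c i * cartan n k i"
      using less.prems by simp
    finally show ?thesis
      using Suc by (auto simp: cartan_def split: if_splits)
  qed
qed

section \<open>Weights and virtual characters\<close>

text \<open>The colour of the block at height \<open>k + 1\<close> above the ground-state wall: one period consists of
  the heights \<open>k = 0, \<dots>, 2n + 1\<close>, with colours \<open>0, \<dots>, n, n, \<dots>, 0\<close>.\<close>

definition color :: "nat \<Rightarrow> nat \<Rightarrow> nat" where
  "color n k = (let r = k mod (2 * Delta n) in if r \<le> n then r else 2 * n + 1 - r)"

text \<open>A block is the pair of its column and its position \<open>k\<close> in that column.\<close>

definition num_blocks :: "nat \<Rightarrow> (nat \<Rightarrow> nat) \<Rightarrow> nat \<Rightarrow> nat" where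
  "num_blocks n l i = card {(j, k). k < l j \<and> color n k = i}"

definition wt :: "nat \<Rightarrow> (nat \<Rightarrow> nat) \<Rightarrow> weight" where
  "wt n l = fund_weight 0 - (\<Sum>i\<le>n. frag_cmul (int (num_blocks n l i)) (simple_root n i))"

definition of_weight :: "nat \<Rightarrow> (nat \<Rightarrow> nat) set \<Rightarrow> weight \<Rightarrow> (nat \<Rightarrow> nat) set" where
  "of_weight n A mu = {l \<in> A. wt n l = mu}"

text \<open>A formal sum $\sum_{\mu \in P} c_\mu e(\mu)$, possibly infinite, is the family of its
  coefficients $\mu \mapsto c_\mu$, which is 0 outside \<open>P\<close>. The sets counted are finite for
  \<open>A \<subseteq> proper_walls n\<close> and \<open>n \<ge> 2\<close> (see \<open>finite_of_weight\<close>), so \<open>card\<close> is the true cardinality.\<close>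

definition virtual_character :: "nat \<Rightarrow> (nat \<Rightarrow> nat) set \<Rightarrow> (weight \<Rightarrow> int)" where
  "virtual_character n A = (\<lambda>mu. if mu \<in> weight_lattice n then int (card (of_weight n A mu)) else 0)"

lemma fund_weight_in_weight_lattice: "i \<le> n \<Longrightarrow> fund_weight i \<in> weight_lattice n"
  by (auto simp: weight_lattice_def fund_weight_def)

lemma simple_root_in_weight_lattice: "simple_root n j \<in> weight_lattice n"
proof -
  have "Poly_Mapping.lookup (simple_root n j) x = 0" if "x \<notin> Fund ` {..n} \<union> {Null}" for x
    using that
    by (auto simp: simple_root_def lookup_add lookup_sum_frag_cmul fund_weight_def intro!: sum.neutral)
  then show ?thesis
    unfolding weight_lattice_def by (metis (mono_tags) in_keys_iff mem_Collect_eq subsetI)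
qed

lemma wt_in_weight_lattice: "wt n l \<in> weight_lattice n"
proof -
  have root: "Poly_Mapping.lookup (simple_root n j) x = 0" if "x \<notin> Fund ` {..n} \<union> {Null}" for x j
    using that simple_root_in_weight_lattice[of n j]
    unfolding weight_lattice_def by (metis (mono_tags) in_keys_iff mem_Collect_eq subsetD)
  have "Poly_Mapping.lookup (wt n l) x = 0" if "x \<notin> Fund ` {..n} \<union> {Null}" for x
    using that root[OF that]
    by (auto simp: wt_def lookup_minus lookup_sum_frag_cmul fund_weight_def)
  then show ?thesis
    unfolding weight_lattice_def by (metis (mono_tags) in_keys_iff mem_Collect_eq subsetI)
qed

lemma color_le: "color n k \<le> n"
  by (auto simp: color_def Let_def)

lemma sum_num_blocks:
  assumes "is_partition l"
  shows "(\<Sum>i\<le>n. num_blocks n l i) = psize l"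
proof -
  let ?J = "{j. l j \<noteq> 0}" and ?B = "\<lambda>i. {(j, k). k < l j \<and> color n k = i}"
  have fin: "finite ?J"
    using assms by (simp add: is_partition_def)
  have blocks: "{(j, k). k < l j} = Sigma ?J (\<lambda>j. {..<l j})"
    by auto
  have "finite {(j, k). k < l j}"
    unfolding blocks using fin by auto
  then have finB: "finite (?B i)" for i
    by (rule rev_finite_subset) auto
  have "(\<Sum>i\<le>n. num_blocks n l i) = card (\<Union>i\<in>{..n}. ?B i)"
    unfolding num_blocks_def by (rule card_UN_disjoint [symmetric]) (use finB in auto)
  also have "(\<Union>i\<in>{..n}. ?B i) = Sigma ?J (\<lambda>j. {..<l j})"
    using color_le by auto
  also have "card \<dots> = psize l"
    using fin by (simp add: psize_def)
  finally show ?thesis .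
qed

lemma finite_of_size:
  assumes "A \<subseteq> proper_walls n"
  shows "finite (of_size A m)"
proof -
  have bound: "l i \<le> m \<and> (m < i \<longrightarrow> l i = 0)" if "l \<in> of_size A m" for l i
  proof -
    have p: "is_partition l" and m: "psize l = m"
      using that assms by (auto simp: of_size_def proper_walls_def)
    then have fin: "finite {i. l i \<noteq> 0}"
      by (simp add: is_partition_def)
    have "l i \<le> m"
      using member_le_sum[of i "{i. l i \<noteq> 0}" l] fin m by (cases "l i = 0") (auto simp: psize_def)
    moreover have "l i = 0" if "m < i"
    proof (rule ccontr)
      assume pos: "l i \<noteq> 0"
      have mono: "l i \<le> l j" if "j \<le> i" for j
        by (rule lift_Suc_antimono_le[of l]) (use p that in \<open>auto simp: is_partition_def\<close>)
      have sub: "{..i} \<subseteq> {i. l i \<noteq> 0}"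
      proof
        fix j
        assume "j \<in> {..i}"
        then have "l i \<le> l j"
          using mono by simp
        then show "j \<in> {i. l i \<noteq> 0}"
          using pos by simp
      qed
      have "i < (\<Sum>j\<le>i. 1)"
        by simp
      also have "(\<Sum>j\<le>i. 1) \<le> sum l {..i}"
      proof (rule sum_mono)
        fix j
        assume "j \<in> {..i}"
        then have "l i \<le> l j"
          using mono by simp
        then show "1 \<le> l j"
          using pos by simp
      qed
      also have "\<dots> \<le> psize l"
        unfolding psize_def using fin sub by (intro sum_mono2) auto
      finally show False
        using m that by simp
    qed
    ultimately show ?thesis
      by simp
  qed
  have "of_size A m \<subseteq> {l. \<forall>i. (i \<in> {..m} \<longrightarrow> l i \<in> {..m}) \<and> (i \<notin> {..m} \<longrightarrow> l i = 0)}"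
    using bound by (auto simp: not_le)
  moreover have "finite {l. \<forall>i. (i \<in> {..m} \<longrightarrow> l i \<in> {..m}) \<and> (i \<notin> {..m} \<longrightarrow> l i = (0::nat))}"
    by (rule finite_set_of_finite_funs) auto
  ultimately show ?thesis
    by (rule finite_subset)
qed

lemma finite_of_weight:
  assumes A: "A \<subseteq> proper_walls n" and n: "n \<ge> 2"
  shows "finite (of_weight n A mu)"
proof (cases "of_weight n A mu = {}")
  case False
  then obtain l where l: "l \<in> of_weight n A mu"
    by auto
  have "psize l' = psize l" if l': "l' \<in> of_weight n A mu" for l'
  proof -
    have "wt n l = wt n l'"
      using l l' by (simp add: of_weight_def)
    then have "(\<Sum>i\<le>n. frag_cmul (int (num_blocks n l i) - int (num_blocks n l' i)) (simple_root n i)) = 0"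
      by (simp add: wt_def frag_cmul_diff_distrib sum_subtractf)
    from simple_roots_independent[OF n this]
    have "num_blocks n l i = num_blocks n l' i" if "i \<le> n" for i
      using that by fastforce
    then have "(\<Sum>i\<le>n. num_blocks n l i) = (\<Sum>i\<le>n. num_blocks n l' i)"
      by (intro sum.cong) auto
    moreover have "is_partition l" "is_partition l'"
      using l l' A by (auto simp: of_weight_def proper_walls_def)
    ultimately show ?thesis
      by (simp add: sum_num_blocks)
  qed
  then have "of_weight n A mu \<subseteq> of_size A (psize l)"
    by (auto simp: of_weight_def of_size_def)
  then show ?thesis
    using finite_of_size[OF A] by (rule finite_subset)
qed simp

end

theory Submission
  imports Defs "HOL-Library.Multiset"
begin

text \<open>
  Strict partitions and reduced walls are compared through the set of all proper walls, which
  factors in two ways over the set of all partitions \<open>\<nu>\<close>. Write \<open>\<Delta> = n + 1\<close>.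

  A proper wall is \<open>\<kappa> + 2\<Delta>\<nu>\<close> (column by column) for exactly one reduced wall \<open>\<kappa>\<close> and one
  partition \<open>\<nu>\<close>: adding \<open>2\<Delta>\<nu>\<close> changes neither the residues of the columns nor the residues of
  their differences. In every residue class modulo \<open>2\<Delta>\<close> exactly one difference is admissible in
  a reduced wall; in the class of 0 this is 0 at columns whose height is a multiple of \<open>\<Delta>\<close> and
  \<open>2\<Delta>\<close> at all others (\<open>bij_reduced_times_partitions\<close>).

  A proper wall also arises from exactly one strict partition \<open>\<sigma>\<close> and one partition \<open>\<nu>\<close> by
  adding to the parts of \<open>\<sigma>\<close> two copies of \<open>t\<Delta>\<close> for each part \<open>t\<close> of \<open>\<nu>\<close>: only multiples of
  \<open>\<Delta>\<close> are repeated in a proper wall, and multiplicities are divided by two with remainder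
  (\<open>bij_strict_times_partitions\<close>).

  In both cases \<open>\<nu>\<close> contributes \<open>2|\<nu>|\<close> blocks of each colour, since any \<open>\<Delta>\<close> successive blocks
  that start at a multiple of \<open>\<Delta>\<close> show each colour once. Hence the numbers of strict partitions
  and of reduced walls, refined by size and weight, have the same convolution with the numbers of
  partitions. As there is exactly one partition of 0, the convolution can be undone by induction on
  the size (\<open>card_fibre_cancel\<close>). In terms of generating functions, with \<open>z\<close> marking one block of
  each colour, this is the identity \<open>\<Prod>(1 + z\<^sup>k) = \<Prod>(1 - z\<^sup>2\<^sup>k) / (1 - z\<^sup>k)\<close>: the parts that are
  multiples of \<open>\<Delta>\<close> contribute the left side to strict partitions and \<open>\<Prod>1 / (1 - z\<^sup>k)\<close> to proper
  walls, from which \<open>\<nu>\<close> splits off \<open>\<Prod>1 / (1 - z\<^sup>2\<^sup>k)\<close>.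
\<close>

section \<open>Cancelling a common factor\<close>

lemma card_fibre_product:
  fixes s :: "'a \<Rightarrow> nat" and w :: "'a \<Rightarrow> 'w :: ab_group_add"
  assumes bij: "bij_betw f (A \<times> P) F"
    and s: "\<And>a p. a \<in> A \<Longrightarrow> p \<in> P \<Longrightarrow> s (f (a, p)) = s a + h p"
    and w: "\<And>a p. a \<in> A \<Longrightarrow> p \<in> P \<Longrightarrow> w (f (a, p)) = w a + v p"
    and finP: "finite {p \<in> P. h p \<le> m}"
    and finA: "\<And>k u. finite {a \<in> A. s a = k \<and> w a = u}"
  shows "card {x \<in> F. s x = m \<and> w x = u} =
         (\<Sum>p\<in>{p \<in> P. h p \<le> m}. card {a \<in> A. s a = m - h p \<and> w a = u - v p})"
proof -
  let ?G = "{ap \<in> A \<times> P. s (f ap) = m \<and> w (f ap) = u}"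
  let ?H = "Sigma {p \<in> P. h p \<le> m} (\<lambda>p. {a \<in> A. s a = m - h p \<and> w a = u - v p})"
  have "bij_betw f ?G {x \<in> F. s x = m \<and> w x = u}"
    using bij by (auto simp: bij_betw_def inj_on_def)
  then have "card {x \<in> F. s x = m \<and> w x = u} = card ?G"
    by (rule bij_betw_same_card [symmetric])
  also have "?G = prod.swap ` ?H"
  proof (intro set_eqI iffI)
    fix x assume "x \<in> ?G"
    then have "prod.swap x \<in> ?H"
      using s w by (auto simp: prod.swap_def)
    then show "x \<in> prod.swap ` ?H"
      by (rule image_eqI [rotated]) (simp add: prod.swap_def)
  next
    fix x assume "x \<in> prod.swap ` ?H"
    then show "x \<in> ?G"
      using s w by auto
  qed
  also have "card \<dots> = card ?H"
    by (rule card_image) (rule inj_swap)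
  also have "\<dots> = (\<Sum>p\<in>{p \<in> P. h p \<le> m}. card {a \<in> A. s a = m - h p \<and> w a = u - v p})"
    using finP finA by (intro card_SigmaI) auto
  finally show ?thesis .
qed

text \<open>In the convolution formula of \<open>card_fibre_product\<close>, the summand of \<open>e\<close> is the number sought
  and all other summands concern smaller sizes, so that induction on the size applies.\<close>

lemma card_fibre_cancel:
  fixes s :: "'a \<Rightarrow> nat" and w :: "'a \<Rightarrow> 'w :: ab_group_add"
  assumes f: "bij_betw f (A \<times> P) F"
    and fs: "\<And>a p. a \<in> A \<Longrightarrow> p \<in> P \<Longrightarrow> s (f (a, p)) = s a + h p"
    and fw: "\<And>a p. a \<in> A \<Longrightarrow> p \<in> P \<Longrightarrow> w (f (a, p)) = w a + v p"
    and g: "bij_betw g (B \<times> P) F"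
    and gs: "\<And>b p. b \<in> B \<Longrightarrow> p \<in> P \<Longrightarrow> s (g (b, p)) = s b + h p"
    and gw: "\<And>b p. b \<in> B \<Longrightarrow> p \<in> P \<Longrightarrow> w (g (b, p)) = w b + v p"
    and finP: "\<And>m. finite {p \<in> P. h p \<le> m}"
    and finA: "\<And>m u. finite {a \<in> A. s a = m \<and> w a = u}"
    and finB: "\<And>m u. finite {b \<in> B. s b = m \<and> w b = u}"
    and e: "e \<in> P" "v e = 0" "\<And>p. p \<in> P \<Longrightarrow> h p = 0 \<longleftrightarrow> p = e"
  shows "card {a \<in> A. s a = m \<and> w a = u} = card {b \<in> B. s b = m \<and> w b = u}"
proof (induction m arbitrary: u rule: less_induct)
  case (less m)
  let ?Q = "{p \<in> P. h p \<le> m}"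
  let ?a = "\<lambda>p. card {a \<in> A. s a = m - h p \<and> w a = u - v p}"
  let ?b = "\<lambda>p. card {b \<in> B. s b = m - h p \<and> w b = u - v p}"
  have "sum ?a ?Q = sum ?b ?Q"
    using card_fibre_product[of f A P F s h w v m u, OF f fs fw finP finA]
      card_fibre_product[of g B P F s h w v m u, OF g gs gw finP finB] by simp
  moreover have "e \<in> ?Q"
    using e(1) e(3)[of e] by simp
  then have "sum ?a ?Q = ?a e + sum ?a (?Q - {e})" "sum ?b ?Q = ?b e + sum ?b (?Q - {e})"
    by (rule sum.remove[OF finP])+
  ultimately have "?a e + sum ?a (?Q - {e}) = ?b e + sum ?b (?Q - {e})"
    by linarith
  moreover have "sum ?a (?Q - {e}) = sum ?b (?Q - {e})"
  proof (rule sum.cong)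
    fix p assume "p \<in> ?Q - {e}"
    then have "m - h p < m"
      using e(3)[of p] by auto
    then show "?a p = ?b p"
      by (rule less.IH)
  qed simp
  ultimately have "?a e = ?b e"
    by linarith
  then show ?case
    using e(1,2) e(3)[of e] by simp
qed

section \<open>Partitions as multisets of positive parts\<close>

lemma Delta_nonzero [simp]: "Delta n \<noteq> 0"
  by (simp add: Delta_def)

lemma is_partition_antimono: "is_partition l \<Longrightarrow> i \<le> j \<Longrightarrow> l j \<le> l i"
  by (rule lift_Suc_antimono_le[of l]) (auto simp: is_partition_def)

definition parts :: "(nat \<Rightarrow> nat) \<Rightarrow> nat multiset" where
  "parts l = image_mset l (mset_set {i. l i \<noteq> 0})"

lemma sum_mset_parts: "(\<Sum>x\<in>#parts l. f x) = (\<Sum>i | l i \<noteq> 0. f (l i))"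
  by (simp only: parts_def sum_unfold_sum_mset multiset.map_comp comp_def)

lemma psize_eq_sum_mset: "psize l = sum_mset (parts l)"
  using sum_mset_parts[of "\<lambda>x. x" l] by (simp add: psize_def)

lemma zero_notin_parts: "is_partition l \<Longrightarrow> 0 \<notin># parts l"
  by (auto simp: parts_def is_partition_def)

lemma count_parts:
  assumes "is_partition l" "x \<noteq> 0"
  shows "count (parts l) x = card {i. l i = x}"
proof -
  have "count (parts l) x = card (l -` {x} \<inter> {i. l i \<noteq> 0})"
    using assms unfolding parts_def is_partition_def
    by (simp add: count_image_mset sum.If_cases)
  also have "l -` {x} \<inter> {i. l i \<noteq> 0} = {i. l i = x}"
    using assms by auto
  finally show ?thesis .
qed

text \<open>Equal parts of a partition occupy consecutive columns.\<close>

lemma repeated_part_iff: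
  assumes l: "is_partition l" and x: "x \<noteq> 0"
  shows "count (parts l) x > 1 \<longleftrightarrow> (\<exists>i. l i = x \<and> l (Suc i) = x)"
proof -
  have "finite {i. l i \<noteq> 0}"
    using l by (simp add: is_partition_def)
  then have fin: "finite {i. l i = x}"
    by (rule rev_finite_subset) (use x in auto)
  show ?thesis
  proof
    assume "count (parts l) x > 1"
    then have "\<not> card {i. l i = x} \<le> Suc 0"
      using count_parts[OF assms] by simp
    then obtain a b where ab: "l a = x" "l b = x" "a \<noteq> b"
      unfolding card_le_Suc0_iff_eq[OF fin] by blast
    then have "a < b \<or> b < a"
      by linarith
    with ab have "\<exists>i j. l i = x \<and> l j = x \<and> i < j"
      by blast
    then obtain i j where ij: "l i = x" "l j = x" "i < j"
      by blast
    then have "l (Suc i) = x"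
      using is_partition_antimono[OF l, of i "Suc i"] is_partition_antimono[OF l, of "Suc i" j]
      by simp
    then show "\<exists>i. l i = x \<and> l (Suc i) = x"
      using ij by auto
  next
    assume "\<exists>i. l i = x \<and> l (Suc i) = x"
    then obtain i where "{i, Suc i} \<subseteq> {i. l i = x}"
      by blast
    from card_mono[OF fin this] show "count (parts l) x > 1"
      using count_parts[OF assms] by simp
  qed
qed

lemma proper_walls_iff_parts:
  "l \<in> proper_walls n \<longleftrightarrow>
     is_partition l \<and> (\<forall>x. count (parts l) x > 1 \<longrightarrow> Delta n dvd x)" (is "?L \<longleftrightarrow> ?R")
proof
  assume L: ?L
  then have l: "is_partition l"
    by (simp add: proper_walls_def)
  moreover have "Delta n dvd x" if repeated: "count (parts l) x > 1" for x
  proof (cases "x = 0")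
    case False
    then obtain i where i: "l i = x" "l (Suc i) = x"
      using repeated_part_iff[OF l False] repeated by blast
    have "l i = l (Suc i) \<longrightarrow> (\<exists>t. l i = t * Delta n)"
      using L unfolding proper_walls_def by blast
    then show ?thesis
      using i by (metis dvd_triv_right)
  qed simp
  ultimately show ?R
    by simp
next
  assume R: ?R
  have "\<exists>t. l i = t * Delta n" if "l i = l (Suc i)" for i
  proof (cases "l i = 0")
    case False
    have "\<exists>j. l j = l i \<and> l (Suc j) = l i"
      using that by (intro exI[of _ i]) simp
    then have "count (parts l) (l i) > 1"
      using R repeated_part_iff[of l "l i"] False by blast
    then have "Delta n dvd l i"
      using R by blast
    then obtain t where "l i = Delta n * t"
      by (rule dvdE)
    then have "l i = t * Delta n"
      by simp
    then show ?thesis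
      by blast
  next
    case True
    then show ?thesis
      by (intro exI[of _ 0]) simp
  qed
  then show ?L
    using R unfolding proper_walls_def by blast
qed

lemma strict_partitions_iff_parts:
  "l \<in> strict_partitions n \<longleftrightarrow> is_partition l \<and> (\<forall>x. count (parts l) x \<le> 1)" (is "?L \<longleftrightarrow> ?R")
proof
  assume L: ?L
  then have l: "is_partition l"
    by (simp add: strict_partitions_eq)
  moreover have "count (parts l) x \<le> 1" for x
  proof (cases "x = 0")
    case True
    then show ?thesis
      using zero_notin_parts[OF l] by (simp add: not_in_iff)
  next
    case False
    have "\<not> (\<exists>i. l i = x \<and> l (Suc i) = x)"
    proof
      assume "\<exists>i. l i = x \<and> l (Suc i) = x"
      then obtain i where i: "l i = x" "l (Suc i) = x"
        by blast
      moreover have "l i = l (Suc i) \<longrightarrow> l i = 0"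
        using L by (simp add: strict_partitions_eq)
      ultimately show False
        using False by simp
    qed
    then show ?thesis
      using repeated_part_iff[OF l False] by (meson not_le)
  qed
  ultimately show ?R
    by simp
next
  assume R: ?R
  then have "l i = 0" if "l i = l (Suc i)" for i
    using repeated_part_iff[of l "l i"] that by (metis not_le)
  then show ?L
    using R by (simp add: strict_partitions_eq)
qed

text \<open>The multiset of parts determines the columns by conjugation: the columns of height at least
  \<open>x\<close> are the first ones, and the parts say how many they are.\<close>

lemma le_column_iff:
  assumes l: "is_partition l" and x: "x > 0"
  shows "x \<le> l i \<longleftrightarrow> i < size {#y \<in># parts l. x \<le> y#}"
proof -
  let ?S = "{j. x \<le> l j}"
  have fin: "finite {j. l j \<noteq> 0}"
    using l by (simp add: is_partition_def)
  have sub: "?S \<subseteq> {j. l j \<noteq> 0}"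
    using x by auto
  have finS: "finite ?S"
    using fin sub by (rule rev_finite_subset)
  have "size {#y \<in># parts l. x \<le> y#} = card {j \<in> {j. l j \<noteq> 0}. x \<le> l j}"
    using fin by (simp add: parts_def filter_mset_image_mset filter_mset_mset_set)
  also have "{j \<in> {j. l j \<noteq> 0}. x \<le> l j} = ?S"
    using x by auto
  finally have size: "size {#y \<in># parts l. x \<le> y#} = card ?S" .
  show ?thesis
  proof
    assume i: "x \<le> l i"
    have "x \<le> l j" if "j \<le> i" for j
      using is_partition_antimono[OF l that] i by linarith
    then have "card {..i} \<le> card ?S"
      by (intro card_mono finS) auto
    then show "i < size {#y \<in># parts l. x \<le> y#}"
      using size by simp
  next
    assume i: "i < size {#y \<in># parts l. x \<le> y#}"
    show "x \<le> l i"
    proof (rule ccontr)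
      assume "\<not> x \<le> l i"
      then have "j < i" if "x \<le> l j" for j
        using is_partition_antimono[OF l, of i j] that by (meson le_trans not_le)
      then have "card ?S \<le> card {..<i}"
        by (intro card_mono) auto
      then show False
        using i size by simp
    qed
  qed
qed

lemma parts_inject:
  assumes "is_partition l" "is_partition l'" "parts l = parts l'"
  shows "l = l'"
proof
  fix i
  have "x \<le> l i \<longleftrightarrow> x \<le> l' i" if "x > 0" for x
    using le_column_iff[OF assms(1) that, of i] le_column_iff[OF assms(2) that, of i] assms(3)
    by simp
  then show "l i = l' i"
    by (metis gr0I le_antisym le_refl not_less_zero zero_le)
qed

lemma parts_surj:
  assumes "0 \<notin># M"
  shows "\<exists>l. is_partition l \<and> parts l = M"
proof -
  define xs where "xs = rev (sorted_list_of_multiset M)"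
  define l where "l i = (if i < length xs then xs ! i else 0)" for i
  have mset: "mset xs = M"
    by (simp add: xs_def)
  have "l (Suc i) \<le> l i" for i
  proof (cases "Suc i < length xs")
    case True
    have "sorted_wrt (\<ge>) xs"
      by (simp add: xs_def sorted_wrt_rev)
    from sorted_wrt_nth_less[OF this _ True, of i] show ?thesis
      using True by (simp add: l_def)
  qed (simp add: l_def)
  moreover have "xs ! i \<noteq> 0" if "i < length xs" for i
    using that assms mset nth_mem[of i xs] by (metis set_mset_mset)
  then have supp: "{i. l i \<noteq> 0} = {0..<length xs}"
    by (auto simp: l_def)
  moreover have "parts l = mset (map l [0..<length xs])"
    by (simp only: parts_def supp) simp
  moreover have "map l [0..<length xs] = xs"
    by (rule nth_equalityI) (auto simp: l_def)
  ultimately have "is_partition l" "parts l = M"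
    using mset by (simp_all add: is_partition_def)
  then show ?thesis
    by blast
qed

definition partition_of :: "nat multiset \<Rightarrow> nat \<Rightarrow> nat" where
  "partition_of M = (SOME l. is_partition l \<and> parts l = M)"

lemma partition_of:
  assumes "0 \<notin># M"
  shows "is_partition (partition_of M)" "parts (partition_of M) = M"
  using someI_ex[OF parts_surj[OF assms]] by (auto simp: partition_of_def)

section \<open>Counting blocks by colour\<close>

definition column_content :: "nat \<Rightarrow> nat \<Rightarrow> nat \<Rightarrow> nat" where
  "column_content n i x = card {k. k < x \<and> color n k = i}"

lemma num_blocks_eq_sum:
  assumes "finite J" "{j. l j \<noteq> 0} \<subseteq> J"
  shows "num_blocks n l i = (\<Sum>j\<in>J. column_content n i (l j))"
proof -
  have "{(j, k). k < l j \<and> color n k = i} = Sigma J (\<lambda>j. {k. k < l j \<and> color n k = i})"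
    using assms(2) by auto
  then show ?thesis
    using assms(1) by (simp add: num_blocks_def column_content_def)
qed

lemma num_blocks_eq_sum_mset:
  assumes "is_partition l"
  shows "num_blocks n l i = (\<Sum>x\<in>#parts l. column_content n i x)"
  using assms num_blocks_eq_sum[of "{j. l j \<noteq> 0}" l n i]
  by (simp add: sum_mset_parts is_partition_def)

lemma color_half_period:
  assumes "r \<le> n"
  shows "color n (t * Delta n + r) = (if even t then r else n - r)"
proof (cases "even t")
  case True
  then obtain q where "t = 2 * q"
    by blast
  then have "(t * Delta n + r) mod (2 * Delta n) = (r + q * (2 * Delta n)) mod (2 * Delta n)"
    by (simp add: algebra_simps)
  also have "\<dots> = r"
    using assms by (subst mod_mult_self1) (simp add: Delta_def)
  finally show ?thesis
    using True assms by (simp add: color_def)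
next
  case False
  then obtain q where "t = 2 * q + 1"
    by (rule oddE)
  then have "(t * Delta n + r) mod (2 * Delta n) = (Delta n + r + q * (2 * Delta n)) mod (2 * Delta n)"
    by (simp add: algebra_simps)
  also have "\<dots> = Delta n + r"
    using assms by (subst mod_mult_self1) (simp add: Delta_def)
  finally show ?thesis
    using False assms by (simp add: color_def Delta_def)
qed

text \<open>Within each half period of \<open>\<Delta>\<close> blocks the colours run once through all of \<open>0, \<dots>, n\<close>,
  upwards or downwards.\<close>

lemma column_content_multiple:
  assumes "i \<le> n"
  shows "column_content n i (t * Delta n) = t"
proof (induction t)
  case (Suc t)
  define k where "k = t * Delta n + (if even t then i else n - i)"
  have "{j. j < Suc t * Delta n \<and> color n j = i} = insert k {j. j < t * Delta n \<and> color n j = i}"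
  proof (intro set_eqI iffI)
    fix j assume j: "j \<in> {j. j < Suc t * Delta n \<and> color n j = i}"
    show "j \<in> insert k {j. j < t * Delta n \<and> color n j = i}"
    proof (cases "j < t * Delta n")
      case False
      define r where "r = j - t * Delta n"
      have r: "j = t * Delta n + r" "r \<le> n"
        using False j by (auto simp: r_def Delta_def)
      then have "i = (if even t then r else n - r)"
        using j color_half_period[OF r(2), of t] by simp
      then have "j = k"
        using r by (auto simp: k_def)
      then show ?thesis
        by simp
    qed (use j in simp)
  next
    fix j assume "j \<in> insert k {j. j < t * Delta n \<and> color n j = i}"
    moreover have "k < Suc t * Delta n"
      using assms by (simp add: k_def Delta_def less_Suc_eq_le)
    moreover have "color n k = i"
      using assms color_half_period[of "if even t then i else n - i" n t] by (auto simp: k_def)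
    moreover have "t * Delta n \<le> Suc t * Delta n"
      by simp
    ultimately show "j \<in> {j. j < Suc t * Delta n \<and> color n j = i}"
      by (auto intro: less_le_trans)
  qed
  moreover have "k \<notin> {j. j < t * Delta n \<and> color n j = i}"
    by (simp add: k_def)
  ultimately show ?case
    using Suc.IH by (simp add: column_content_def)
qed (simp add: column_content_def)

lemma column_content_shift:
  assumes "i \<le> n"
  shows "column_content n i (x + 2 * Delta n * y) = column_content n i x + 2 * y"
proof -
  let ?d = "2 * Delta n * y"
  have col: "color n (?d + k) = color n k" for k
    by (simp only: color_def mod_mult_self4)
  have "{k. k < x + ?d \<and> color n k = i} =
        {k. k < ?d \<and> color n k = i} \<union> (+) ?d ` {k. k < x \<and> color n k = i}"
  proof (intro set_eqI iffI)
    fix k assume k: "k \<in> {k. k < x + ?d \<and> color n k = i}"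
    show "k \<in> {k. k < ?d \<and> color n k = i} \<union> (+) ?d ` {k. k < x \<and> color n k = i}"
    proof (cases "k < ?d")
      case False
      then have "k = ?d + (k - ?d)" "k - ?d < x"
        using k by auto
      then show ?thesis
        using k col[of "k - ?d"] by auto
    qed (use k in simp)
  qed (auto simp: col)
  then have "column_content n i (x + ?d) =
             column_content n i ?d + card ((+) ?d ` {k. k < x \<and> color n k = i})"
    unfolding column_content_def by (subst card_Un_disjoint [symmetric]) auto
  also have "column_content n i ?d = 2 * y"
    using column_content_multiple[OF assms, of "2 * y"] by (simp add: mult_ac)
  also have "card ((+) ?d ` {k. k < x \<and> color n k = i}) = column_content n i x"
    by (simp add: card_image column_content_def)
  finally show ?thesis
    by simp
qed

text \<open>Since the simple roots of type $D^{(2)}_{n+1}$ add up to the null root $\delta$, this is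
  $-c\delta$.\<close>

definition uniform_weight :: "nat \<Rightarrow> nat \<Rightarrow> weight" where
  "uniform_weight n c = - (\<Sum>i\<le>n. frag_cmul (int c) (simple_root n i))"

lemma size_weight_shift:
  assumes "is_partition l" "is_partition a"
    and "\<And>i. i \<le> n \<Longrightarrow> num_blocks n l i = num_blocks n a i + c"
  shows "psize l = psize a + Delta n * c" "wt n l = wt n a + uniform_weight n c"
proof -
  have "(\<Sum>i\<le>n. num_blocks n l i) = (\<Sum>i\<le>n. num_blocks n a i + c)"
    using assms(3) by (intro sum.cong) auto
  then show "psize l = psize a + Delta n * c"
    using sum_num_blocks[OF assms(1), of n] sum_num_blocks[OF assms(2), of n]
    by (simp add: sum.distrib Delta_def)
  have "(\<Sum>i\<le>n. frag_cmul (int (num_blocks n l i)) (simple_root n i)) =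
        (\<Sum>i\<le>n. frag_cmul (int (num_blocks n a i)) (simple_root n i) +
                 frag_cmul (int c) (simple_root n i))"
    using assms(3) by (intro sum.cong) (auto simp: frag_cmul_distrib)
  then show "wt n l = wt n a + uniform_weight n c"
    by (simp add: wt_def uniform_weight_def sum.distrib)
qed

section \<open>Proper walls from reduced walls\<close>

definition add_multiple :: "nat \<Rightarrow> (nat \<Rightarrow> nat) \<times> (nat \<Rightarrow> nat) \<Rightarrow> nat \<Rightarrow> nat" where
  "add_multiple n = (\<lambda>(k, p) i. k i + 2 * Delta n * p i)"

lemma is_partition_add_multiple:
  assumes "is_partition k" "is_partition p"
  shows "is_partition (add_multiple n (k, p))"
proof -
  have "{i. k i + 2 * Delta n * p i \<noteq> 0} \<subseteq> {i. k i \<noteq> 0} \<union> {i. p i \<noteq> 0}"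
    by auto
  then have "finite {i. k i + 2 * Delta n * p i \<noteq> 0}"
    using assms by (auto simp: is_partition_def intro: finite_subset)
  then show ?thesis
    using assms by (auto simp: is_partition_def add_multiple_def intro!: add_mono mult_left_mono)
qed

lemma num_blocks_add_multiple:
  assumes k: "is_partition k" and p: "is_partition p" and i: "i \<le> n"
  shows "num_blocks n (add_multiple n (k, p)) i = num_blocks n k i + 2 * psize p"
proof -
  let ?J = "{j. k j \<noteq> 0} \<union> {j. p j \<noteq> 0}"
  have J: "finite ?J"
    using k p by (simp add: is_partition_def)
  have "num_blocks n (add_multiple n (k, p)) i =
        (\<Sum>j\<in>?J. column_content n i (k j + 2 * Delta n * p j))"
    using num_blocks_eq_sum[OF J, of "add_multiple n (k, p)" n i]
    by (auto simp: add_multiple_def)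
  also have "\<dots> = (\<Sum>j\<in>?J. column_content n i (k j)) + 2 * (\<Sum>j\<in>?J. p j)"
    by (simp add: column_content_shift[OF i] sum.distrib sum_distrib_left)
  also have "(\<Sum>j\<in>?J. column_content n i (k j)) = num_blocks n k i"
    using num_blocks_eq_sum[OF J, of k n i] by simp
  also have "(\<Sum>j\<in>?J. p j) = psize p"
    unfolding psize_def using J by (intro sum.mono_neutral_right) auto
  finally show ?thesis .
qed

lemma add_multiple_in_proper_walls:
  assumes k: "k \<in> proper_walls n" and p: "is_partition p"
  shows "add_multiple n (k, p) \<in> proper_walls n"
proof -
  have kp: "is_partition k"
    using k by (simp add: proper_walls_def)
  have "\<exists>t. k i + 2 * Delta n * p i = t * Delta n"
    if eq: "k i + 2 * Delta n * p i = k (Suc i) + 2 * Delta n * p (Suc i)" for i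
  proof -
    have "k (Suc i) \<le> k i" "2 * Delta n * p (Suc i) \<le> 2 * Delta n * p i"
      using kp p by (auto simp: is_partition_def)
    then have "k i = k (Suc i)"
      using eq by linarith
    then obtain t where "k i = t * Delta n"
      using k by (auto simp: proper_walls_def)
    then have "k i + 2 * Delta n * p i = (t + 2 * p i) * Delta n"
      by (simp add: algebra_simps)
    then show ?thesis
      by blast
  qed
  then show ?thesis
    using is_partition_add_multiple[OF kp p, of n] by (simp add: proper_walls_def add_multiple_def)
qed

text \<open>Two differences of reduced walls that agree modulo \<open>2\<Delta>\<close> can differ only by being \<open>0\<close> and
  \<open>2\<Delta>\<close>; but \<open>0\<close> requires a multiple of \<open>\<Delta>\<close> and \<open>2\<Delta>\<close> forbids it.\<close>

lemma reduced_difference_unique: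
  assumes k: "k \<in> reduced_walls n" and k': "k' \<in> reduced_walls n"
    and p: "is_partition p" and p': "is_partition p'"
    and eq: "add_multiple n (k, p) = add_multiple n (k', p')"
  shows "k i - k (Suc i) \<le> k' i - k' (Suc i)"
proof (rule ccontr)
  let ?D = "2 * Delta n"
  assume less: "\<not> k i - k (Suc i) \<le> k' i - k' (Suc i)"
  have kp: "is_partition k" "is_partition k'"
    using k k' by (auto simp: reduced_walls_def proper_walls_def)
  have eqi: "k j + ?D * p j = k' j + ?D * p' j" for j
    using fun_cong[OF eq, of j] by (simp add: add_multiple_def)
  have mono: "k (Suc i) \<le> k i" "k' (Suc i) \<le> k' i" "p (Suc i) \<le> p i" "p' (Suc i) \<le> p' i"
    using kp p p' by (auto simp: is_partition_def)
  define a where "a = k i - k (Suc i)"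
  define b where "b = k' i - k' (Suc i)"
  define x where "x = p i - p (Suc i)"
  define y where "y = p' i - p' (Suc i)"
  have "a + ?D * x = b + ?D * y"
  proof -
    have "k i = k (Suc i) + a" "k' i = k' (Suc i) + b" "p i = p (Suc i) + x" "p' i = p' (Suc i) + y"
      using mono by (auto simp: a_def b_def x_def y_def)
    then show ?thesis
      using eqi[of i] eqi[of "Suc i"] by (simp add: algebra_simps)
  qed
  moreover have ab: "b < a" "a \<le> ?D"
    using less k by (auto simp: a_def b_def reduced_walls_def)
  ultimately have "x < y"
    by (metis add_less_le_mono leD le_refl mult_le_mono2 not_le)
  then have "?D * Suc x \<le> ?D * y"
    by (intro mult_le_mono2) simp
  then have "a = ?D" "b = 0"
    using ab \<open>a + ?D * x = b + ?D * y\<close> by auto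
  then have no: "k i \<noteq> t * Delta n" for t
    using k by (auto simp: a_def reduced_walls_def)
  have "k' i = k' (Suc i)"
    using \<open>b = 0\<close> mono by (simp add: b_def)
  then have "Delta n dvd k' i"
    using k' by (auto simp: reduced_walls_def proper_walls_def)
  then have "Delta n dvd k i + ?D * p i"
    using eqi[of i] by simp
  then have "Delta n dvd k i"
    by (metis dvd_add_left_iff dvd_mult2 dvd_triv_right)
  then show False
    using no by (metis dvd_def mult.commute)
qed

lemma eq_if_differences_eq:
  assumes "is_partition k" "is_partition k'" "\<And>i. k i - k (Suc i) = k' i - k' (Suc i)"
  shows "k = k'"
proof
  fix i
  have "finite ({i. k i \<noteq> 0} \<union> {i. k' i \<noteq> 0})"
    using assms by (simp add: is_partition_def)
  then obtain N where N: "\<forall>j\<in>{i. k i \<noteq> 0} \<union> {i. k' i \<noteq> 0}. j < N"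
    using finite_nat_set_iff_bounded by blast
  show "k i = k' i"
  proof (cases "i \<le> N")
    case True
    then show ?thesis
    proof (induction i rule: inc_induct)
      case base
      then show ?case
        using N by (metis (mono_tags) UnCI less_irrefl mem_Collect_eq)
    next
      case (step j)
      moreover have "k (Suc j) \<le> k j" "k' (Suc j) \<le> k' j"
        using assms by (auto simp: is_partition_def)
      ultimately show ?case
        using assms(3)[of j] by linarith
    qed
  next
    case False
    then show ?thesis
      using N by (metis (mono_tags) UnCI less_imp_le mem_Collect_eq)
  qed
qed

text \<open>At a difference that is too large, \<open>2\<Delta>\<close> blocks can be removed from the higher of the two
  columns and from all columns to its right, and the wall stays proper. Repeating this leads to a
  reduced wall; \<open>p\<close> counts the removals column by column.\<close>

lemma ex_reduced_plus_multiple: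
  assumes "l \<in> proper_walls n"
  shows "\<exists>k p. k \<in> reduced_walls n \<and> is_partition p \<and> l = add_multiple n (k, p)"
  using assms
proof (induction "psize l" arbitrary: l rule: less_induct)
  case less
  let ?D = "2 * Delta n"
  have l: "is_partition l" and lp: "\<And>i. l i = l (Suc i) \<Longrightarrow> \<exists>t. l i = t * Delta n"
    using less.prems by (auto simp: proper_walls_def)
  show ?case
  proof (cases "l \<in> reduced_walls n")
    case True
    moreover have "is_partition (\<lambda>_. 0)" "l = add_multiple n (l, \<lambda>_. 0)"
      by (auto simp: is_partition_def add_multiple_def)
    ultimately show ?thesis
      by blast
  next
    case False
    then obtain i where i: "l i - l (Suc i) > ?D \<or> l i - l (Suc i) = ?D \<and> (\<exists>t. l i = t * Delta n)"
      using less.prems by (auto simp: reduced_walls_def not_le)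
    define q :: "nat \<Rightarrow> nat" where "q j = (if j \<le> i then 1 else 0)" for j
    define l' where "l' j = l j - ?D * q j" for j
    have ge: "?D * q j \<le> l j" for j
      using is_partition_antimono[OF l, of j i] i by (auto simp: q_def)
    have l_eq: "l j = l' j + ?D * q j" for j
      using ge[of j] by (simp add: l'_def)
    have q: "is_partition q"
      by (auto simp: is_partition_def q_def)
    have dec: "l (Suc j) \<le> l j" for j
      using l by (simp add: is_partition_def)
    have "l' (Suc j) \<le> l' j" for j
      using dec[of j] i by (cases "j = i") (auto simp: l'_def q_def)
    moreover have "finite {j. l' j \<noteq> 0}"
      by (rule finite_subset[of _ "{j. l j \<noteq> 0}"]) (use l in \<open>auto simp: l'_def is_partition_def\<close>)
    ultimately have l'p: "is_partition l'"
      by (simp add: is_partition_def)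
    have "\<exists>t. l' j = t * Delta n" if eq: "l' j = l' (Suc j)" for j
    proof -
      have "\<exists>t. l j = t * Delta n"
      proof (cases "j = i")
        case True
        then show ?thesis
          using eq i l_eq[of i] l_eq[of "Suc i"] by (auto simp: q_def)
      next
        case False
        then have "q (Suc j) = q j"
          by (auto simp: q_def)
        then show ?thesis
          using lp[of j] eq l_eq[of j] l_eq[of "Suc j"] by simp
      qed
      then obtain t where "l j = t * Delta n"
        by blast
      then have "l' j = (t - 2 * q j) * Delta n"
        by (simp add: l'_def algebra_simps)
      then show ?thesis
        by blast
    qed
    with l'p have l': "l' \<in> proper_walls n"
      by (simp add: proper_walls_def)
    have l_add: "l = add_multiple n (l', q)"
      using l_eq by (auto simp: add_multiple_def)
    have "psize l = psize l' + Delta n * (2 * psize q)"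
      unfolding l_add
      by (rule size_weight_shift(1)[OF is_partition_add_multiple[OF l'p q] l'p
            num_blocks_add_multiple[OF l'p q]])
    moreover have "psize q > 0"
      using member_le_sum[of i "{i. q i \<noteq> 0}" q] q by (simp add: psize_def is_partition_def q_def)
    ultimately have "psize l' < psize l"
      by (simp add: Delta_def)
    then obtain k p where k: "k \<in> reduced_walls n" "is_partition p" "l' = add_multiple n (k, p)"
      using less.hyps l' by blast
    have "is_partition (\<lambda>j. p j + q j)"
    proof -
      have "finite ({j. p j \<noteq> 0} \<union> {j. q j \<noteq> 0})"
        using k(2) q by (simp add: is_partition_def)
      then have "finite {j. p j + q j \<noteq> 0}"
        by (rule rev_finite_subset) auto
      then show ?thesis
        using k(2) q by (auto simp: is_partition_def intro!: add_mono)
    qed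
    moreover have "l = add_multiple n (k, \<lambda>j. p j + q j)"
      using l_add k(3) by (auto simp: add_multiple_def algebra_simps)
    ultimately show ?thesis
      using k(1) by blast
  qed
qed

lemma bij_reduced_times_partitions:
  "bij_betw (add_multiple n) (reduced_walls n \<times> {p. is_partition p}) (proper_walls n)"
proof (rule bij_betw_imageI)
  show "inj_on (add_multiple n) (reduced_walls n \<times> {p. is_partition p})"
  proof (intro inj_onI, clarify)
    fix k p k' p'
    assume k: "k \<in> reduced_walls n" "k' \<in> reduced_walls n"
      and p: "is_partition p" "is_partition p'"
      and eq: "add_multiple n (k, p) = add_multiple n (k', p')"
    have "k = k'"
    proof (rule eq_if_differences_eq)
      show "k i - k (Suc i) = k' i - k' (Suc i)" for i
        using reduced_difference_unique[OF k p eq, of i]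
          reduced_difference_unique[OF k(2,1) p(2,1) eq[symmetric], of i] by simp
    qed (use k in \<open>auto simp: reduced_walls_def proper_walls_def\<close>)
    moreover have "p j = p' j" for j
      using fun_cong[OF eq, of j] \<open>k = k'\<close> by (simp add: add_multiple_def)
    ultimately show "k = k' \<and> p = p'"
      by auto
  qed
  show "add_multiple n ` (reduced_walls n \<times> {p. is_partition p}) = proper_walls n"
    using add_multiple_in_proper_walls ex_reduced_plus_multiple
    by (force simp: reduced_walls_def)
qed

section \<open>Proper walls from strict partitions\<close>

definition insert_pairs :: "nat \<Rightarrow> (nat \<Rightarrow> nat) \<times> (nat \<Rightarrow> nat) \<Rightarrow> nat \<Rightarrow> nat" where
  "insert_pairs n = (\<lambda>(s, p). partition_of
     (parts s + repeat_mset 2 (image_mset (\<lambda>t. t * Delta n) (parts p))))"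

lemma insert_pairs:
  assumes "is_partition s" "is_partition p"
  shows "is_partition (insert_pairs n (s, p))"
    and "parts (insert_pairs n (s, p)) =
         parts s + repeat_mset 2 (image_mset (\<lambda>t. t * Delta n) (parts p))"
proof -
  have "0 \<notin># parts s + repeat_mset 2 (image_mset (\<lambda>t. t * Delta n) (parts p))"
    using zero_notin_parts[OF assms(1)] zero_notin_parts[OF assms(2)]
    by (auto simp: numeral_2_eq_2)
  from partition_of[OF this]
  show "is_partition (insert_pairs n (s, p))"
    and "parts (insert_pairs n (s, p)) =
         parts s + repeat_mset 2 (image_mset (\<lambda>t. t * Delta n) (parts p))"
    by (auto simp: insert_pairs_def)
qed

lemma num_blocks_insert_pairs:
  assumes s: "is_partition s" and p: "is_partition p" and i: "i \<le> n"
  shows "num_blocks n (insert_pairs n (s, p)) i = num_blocks n s i + 2 * psize p"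
  using num_blocks_eq_sum_mset[OF insert_pairs(1)[OF s p], of n n i]
  by (simp add: insert_pairs(2)[OF s p] numeral_2_eq_2 num_blocks_eq_sum_mset[OF s]
      psize_eq_sum_mset multiset.map_comp comp_def column_content_multiple[OF i])

lemma count_image_mset_inj: "inj f \<Longrightarrow> count (image_mset f M) (f x) = count M x"
  by (induction M) (auto simp: inj_eq)

text \<open>The inverse divides the multiplicity of each part by two: the remainder is a multiplicity in
  the strict partition, the quotient one in the other partition.\<close>

lemma bij_strict_times_partitions:
  "bij_betw (insert_pairs n) (strict_partitions n \<times> {p. is_partition p}) (proper_walls n)"
proof (rule bij_betw_imageI)
  let ?d = "\<lambda>t. t * Delta n"
  have inj: "inj ?d"
    by (simp add: inj_def)
  show "inj_on (insert_pairs n) (strict_partitions n \<times> {p. is_partition p})"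
  proof (intro inj_onI, clarify)
    fix s p s' p'
    assume s: "s \<in> strict_partitions n" "s' \<in> strict_partitions n"
      and p: "is_partition p" "is_partition p'"
      and eq: "insert_pairs n (s, p) = insert_pairs n (s', p')"
    have sp: "is_partition s" "is_partition s'"
      using s by (auto simp: strict_partitions_iff_parts)
    have eq': "parts s + repeat_mset 2 (image_mset ?d (parts p)) =
               parts s' + repeat_mset 2 (image_mset ?d (parts p'))"
      using eq insert_pairs(2)[OF sp(1) p(1), of n] insert_pairs(2)[OF sp(2) p(2), of n] by simp
    have cnt: "count (parts s) x = count (parts s') x \<and>
               count (image_mset ?d (parts p)) x = count (image_mset ?d (parts p')) x" for x
    proof -
      have "count (parts s) x \<le> 1" "count (parts s') x \<le> 1"
        using s by (auto simp: strict_partitions_iff_parts)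
      moreover have "count (parts s) x + 2 * count (image_mset ?d (parts p)) x =
                     count (parts s') x + 2 * count (image_mset ?d (parts p')) x"
        using arg_cong[OF eq', of "\<lambda>M. count M x"] by simp
      ultimately show ?thesis
        by presburger
    qed
    then have "parts s = parts s'" "image_mset ?d (parts p) = image_mset ?d (parts p')"
      by (auto intro: multiset_eqI)
    then have "parts s = parts s'" "parts p = parts p'"
      using multiset.inj_map[OF inj] by (auto dest: injD)
    then show "s = s' \<and> p = p'"
      using parts_inject sp p by blast
  qed
  show "insert_pairs n ` (strict_partitions n \<times> {p. is_partition p}) = proper_walls n"
  proof (intro equalityI subsetI)
    fix l assume "l \<in> insert_pairs n ` (strict_partitions n \<times> {p. is_partition p})"
    then obtain s p where s: "s \<in> strict_partitions n" and p: "is_partition p"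
      and l: "l = insert_pairs n (s, p)"
      by auto
    have sp: "is_partition s"
      using s by (simp add: strict_partitions_iff_parts)
    have "Delta n dvd x" if "count (parts l) x > 1" for x
    proof -
      have "count (parts s) x \<le> 1"
        using s by (simp add: strict_partitions_iff_parts)
      then have "count (image_mset ?d (parts p)) x \<noteq> 0"
        using that insert_pairs(2)[OF sp p, of n] l by (cases "count (image_mset ?d (parts p)) x") auto
      then have "x \<in># image_mset ?d (parts p)"
        by (simp add: count_eq_zero_iff)
      then show ?thesis
        by auto
    qed
    then show "l \<in> proper_walls n"
      using insert_pairs(1)[OF sp p, of n] l by (simp add: proper_walls_iff_parts)
  next
    fix l assume "l \<in> proper_walls n"
    then have l: "is_partition l" and dvd: "\<And>x. count (parts l) x > 1 \<Longrightarrow> Delta n dvd x"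
      by (auto simp: proper_walls_iff_parts)
    define S where "S = mset_set {x \<in> set_mset (parts l). odd (count (parts l) x)}"
    define c where "c t = count (parts l) (?d t) div 2" for t
    define Q where "Q = Abs_multiset c"
    have "{t. 0 < c t} \<subseteq> ?d -` set_mset (parts l)"
      by (auto simp: c_def simp flip: count_greater_zero_iff)
    then have "finite {t. 0 < c t}"
      using finite_vimageI[OF finite_set_mset inj] by (rule finite_subset)
    then have Q: "count Q t = count (parts l) (?d t) div 2" for t
      by (simp add: Q_def c_def count_Abs_multiset)
    have S: "count S x = count (parts l) x mod 2" for x
    proof (cases "odd (count (parts l) x)")
      case True
      then have "x \<in># parts l"
        by (metis count_inI even_zero)
      then show ?thesis
        using True by (simp add: S_def odd_iff_mod_2_eq_one)
    qed (simp add: S_def)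
    have sum: "S + repeat_mset 2 (image_mset ?d Q) = parts l"
    proof (rule multiset_eqI)
      fix x
      have "count (image_mset ?d Q) x = count (parts l) x div 2"
      proof (cases "Delta n dvd x")
        case True
        then obtain t where t: "x = ?d t"
          by (metis dvd_def mult.commute)
        then show ?thesis
          using count_image_mset_inj[OF inj, of Q t] Q by simp
      next
        case False
        then have "x \<notin># image_mset ?d Q"
          by auto
        moreover have "count (parts l) x \<le> 1"
          using dvd[of x] False by force
        ultimately show ?thesis
          unfolding not_in_iff by simp
      qed
      then show "count (S + repeat_mset 2 (image_mset ?d Q)) x = count (parts l) x"
        using S by simp
    qed
    have "count (parts l) 0 = 0"
      using zero_notin_parts[OF l] by (simp add: not_in_iff)
    then have "0 \<notin># S" "0 \<notin># Q"
      by (simp_all add: not_in_iff S Q)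
    then obtain s p where s: "is_partition s" "parts s = S" and p: "is_partition p" "parts p = Q"
      using parts_surj by metis
    have "count S x \<le> 1" for x
      unfolding S by simp
    then have "s \<in> strict_partitions n"
      using s by (simp add: strict_partitions_iff_parts)
    moreover have "insert_pairs n (s, p) = l"
      using parts_inject[OF insert_pairs(1)[OF s(1) p(1)] l] insert_pairs(2)[OF s(1) p(1), of n] s(2) p(2) sum
      by simp
    ultimately show "l \<in> insert_pairs n ` (strict_partitions n \<times> {p. is_partition p})"
      using p(1) by (intro image_eqI[of _ _ "(s, p)"]) auto
  qed
qed

section \<open>Equality of the virtual characters\<close>

text \<open>Every partition is a proper wall for \<open>\<Delta> = 1\<close>, which yields finiteness from
  \<open>finite_of_size\<close>.\<close>

lemma finite_partitions_psize_le: "finite {p. is_partition p \<and> psize p \<le> m}"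
proof -
  have "{p. is_partition p \<and> psize p \<le> m} \<subseteq> (\<Union>k\<le>m. of_size (proper_walls 0) k)"
    by (auto simp: of_size_def proper_walls_def Delta_def)
  moreover have "finite (\<Union>k\<le>m. of_size (proper_walls 0) k)"
    using finite_of_size[OF subset_refl] by blast
  ultimately show ?thesis
    by (rule finite_subset)
qed

lemma psize_eq_0_iff:
  assumes "is_partition p"
  shows "psize p = 0 \<longleftrightarrow> p = (\<lambda>_. 0)"
  using assms by (auto simp: psize_def is_partition_def)

theorem theorem3p7:
  fixes m n :: nat
  assumes "n \<ge> 2"
  shows "virtual_character n (of_size (strict_partitions n) m) =
         virtual_character n (of_size (reduced_walls n) m)"
proof -
  let ?P = "{p. is_partition p}"
  let ?h = "\<lambda>p. Delta n * (2 * psize p)"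
  let ?v = "\<lambda>p. uniform_weight n (2 * psize p)"
  have fin: "finite {a \<in> A. psize a = k \<and> wt n a = u}" if "A \<subseteq> proper_walls n" for A k u
    by (rule finite_subset[OF _ finite_of_size[OF that, of k]]) (auto simp: of_size_def)
  have S: "strict_partitions n \<subseteq> proper_walls n" and K: "reduced_walls n \<subseteq> proper_walls n"
    by (auto simp: strict_partitions_def reduced_walls_def)
  have F: "is_partition a" if "a \<in> proper_walls n" for a
    using that by (simp add: proper_walls_def)
  have card: "card {a \<in> strict_partitions n. psize a = m \<and> wt n a = u} =
              card {a \<in> reduced_walls n. psize a = m \<and> wt n a = u}" for u
  proof (rule card_fibre_cancel[where P = ?P and h = ?h and v = ?v and e = "\<lambda>_. 0",
        OF bij_strict_times_partitions[of n] _ _ bij_reduced_times_partitions[of n]])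
    fix a p assume "a \<in> strict_partitions n" "p \<in> ?P"
    then have a: "is_partition a" and p: "is_partition p"
      using S F by auto
    note size_weight_shift[OF insert_pairs(1)[OF a p] a num_blocks_insert_pairs[OF a p]]
    then show "psize (insert_pairs n (a, p)) = psize a + ?h p"
      and "wt n (insert_pairs n (a, p)) = wt n a + ?v p"
      by auto
  next
    fix a p assume "a \<in> reduced_walls n" "p \<in> ?P"
    then have a: "is_partition a" and p: "is_partition p"
      using K F by auto
    note size_weight_shift[OF is_partition_add_multiple[OF a p] a num_blocks_add_multiple[OF a p]]
    then show "psize (add_multiple n (a, p)) = psize a + ?h p"
      and "wt n (add_multiple n (a, p)) = wt n a + ?v p"
      by auto
  next
    show "finite {p \<in> ?P. ?h p \<le> k}" for k
      by (rule finite_subset[OF _ finite_partitions_psize_le[of k]]) (auto simp: Delta_def)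
  next
    show "(\<lambda>_. 0) \<in> ?P" "?v (\<lambda>_. 0) = 0"
      by (auto simp: is_partition_def uniform_weight_def psize_def)
  next
    show "?h p = 0 \<longleftrightarrow> p = (\<lambda>_. 0)" if "p \<in> ?P" for p
      using that psize_eq_0_iff[of p] by simp
  qed (use fin S K in auto)
  have fibre: "of_weight n (of_size A m) u = {a \<in> A. psize a = m \<and> wt n a = u}" for A u
    by (auto simp: of_weight_def of_size_def)
  show ?thesis
    unfolding virtual_character_def fibre card ..
qed

end
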